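(* Let $G=(V,E)$ be a graph and let $v\in V$. For each $U\subseteq N_G(v)$ define $$A_U=\begin{cases}x^{|U|} & \text{if } \bigcap_{u\in U}N_{G-v}(u)=\emptyset,\\ 0 & \text{otherwise.}\end{cases}$$ Then $$N(G,x)=N(G-v,x)+\sum_{\substack{U\subseteq N_G(v)\\ U\neq\emptyset}}(-1)^{|U|+1}x(1+x)^{|\bigcap_{u\in U}N_{G-v}(u)|}+\sum_{\substack{U\subseteq N_G(v)\\ U\neq\emptyset}}A_U.$$
   Context: All graphs are simple, finite and undirected. For a graph $G=(V,E)$ and $v\in V$, $N_G(v)=\{u\in V: \{u,v\}\in E\}$ is the open neighborhood of $v$, and $G-v$ is the subgraph of $G$ induced by $V\setminus\{v\}$. The neighborhood complex of $G$ is $\mathcal N(G)=\{A\subseteq V : \exists v\in V,\ A\subseteq N_G(v)\}$, and the neighborhood polynomial of $G$ is $N(G,x)=\sum_{A\in\mathcal N(G)}x^{|A|}$.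
   Formalization: The formal statement assumes that G has a vertex other than v; for the one-vertex graph, G−v has no vertices, its neighborhood complex is empty by the given definition, and the identity would read 1 = 0. *)

theory Defs
  imports Main "HOL-Computational_Algebra.Polynomial"
begin

type_synonym 'a graph = "'a set \<times> 'a set set"

abbreviation verts :: "'a graph \<Rightarrow> 'a set" where
  "verts G \<equiv> fst G"

abbreviation edges :: "'a graph \<Rightarrow> 'a set set" where
  "edges G \<equiv> snd G"

definition simple_graph :: "'a graph \<Rightarrow> bool" where
  "simple_graph G \<longleftrightarrow> finite (verts G) \<and> (\<forall>e\<in>edges G. e \<subseteq> verts G \<and> card e = 2)"

definition neighborhood :: "'a graph \<Rightarrow> 'a \<Rightarrow> 'a set" where
  "neighborhood G v = {u \<in> verts G. {u, v} \<in> edges G}"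

definition induced_subgraph :: "'a graph \<Rightarrow> 'a set \<Rightarrow> 'a graph" where
  "induced_subgraph G S = (S, {e \<in> edges G. e \<subseteq> S})"

definition delete_vertex :: "'a graph \<Rightarrow> 'a \<Rightarrow> 'a graph" where
  "delete_vertex G v = induced_subgraph G (verts G - {v})"

text \<open>
  The witness ranges over the vertices of the graph, so the complex of the graph
  without vertices is empty, whereas that of any other graph contains the empty set.
\<close>

definition neighborhood_complex :: "'a graph \<Rightarrow> 'a set set" where
  "neighborhood_complex G = {A. A \<subseteq> verts G \<and> (\<exists>v\<in>verts G. A \<subseteq> neighborhood G v)}"

definition neighborhood_poly :: "'a graph \<Rightarrow> int poly" where
  "neighborhood_poly G = (\<Sum>A\<in>neighborhood_complex G. monom 1 (card A))"

end

theory Submission imports Defs begin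

text \<open>
  Split the members of the complex of \<open>G\<close> by whether they contain \<open>v\<close>. Those that do are the sets
  \<open>insert v B\<close> with \<open>B \<subseteq> N\<^bsub>G-v\<^esub>(u)\<close> for some \<open>u \<in> N\<^bsub>G\<^esub>(v)\<close>; inclusion-exclusion over \<open>u\<close>, together
  with \<open>(\<Sum>B \<subseteq> S. x\<^bsup>|B|\<^esup>) = (1 + x)\<^bsup>|S|\<^esup>\<close>, gives the alternating sum. Those that do not are either in
  the complex of \<open>G - v\<close> or are witnessed by \<open>v\<close> alone, that is, they are the nonempty
  \<open>U \<subseteq> N\<^bsub>G\<^esub>(v)\<close> without a common neighbour in \<open>G - v\<close>.
\<close>

text \<open>\<open>sum g\<close> is additive on disjoint finite sets, so it can serve as the measure
  in \<open>Incl_Excl\<close>. Values in any ring allow polynomial weights.\<close>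

lemma sum_UNION_inclusion_exclusion:
  fixes g :: "'b \<Rightarrow> 'c::ring_1"
  assumes "finite A" and "\<And>a. a \<in> A \<Longrightarrow> finite (X a)"
  shows "sum g (\<Union>a\<in>A. X a) = (\<Sum>B | B \<subseteq> A \<and> B \<noteq> {}. (- 1) ^ (card B + 1) * sum g (\<Inter>a\<in>B. X a))"
proof -
  interpret Incl_Excl finite "sum g"
    by unfold_locales (auto simp: sum.union_disjoint disjnt_def)
  show ?thesis
    using assms by (rule restricted_indexed)
qed

text \<open>Expanding the product of \<open>card S\<close> factors \<open>x + 1\<close>, each subset
  of \<open>S\<close> records the factors from which \<open>x\<close> is taken.\<close>

lemma sum_Pow_power_card:
  fixes x :: "'b::comm_ring_1"
  assumes "finite S"
  shows "(\<Sum>B\<in>Pow S. x ^ card B) = (1 + x) ^ card S"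
  using prod_add[OF assms, of "\<lambda>_. x" "\<lambda>_. 1"] by (simp add: add.commute)

lemma simple_graph_no_loop:
  assumes "simple_graph G"
  shows "{v, v} \<notin> edges G"
  using assms by (auto simp: simple_graph_def)

lemma neighborhood_delete_vertex:
  "neighborhood (delete_vertex G v) u = (if u \<in> verts G \<and> u \<noteq> v then neighborhood G u - {v} else {})"
  by (auto simp: neighborhood_def delete_vertex_def induced_subgraph_def)

lemma verts_delete_vertex: "verts (delete_vertex G v) = verts G - {v}"
  by (simp add: delete_vertex_def induced_subgraph_def)

lemma neighborhood_delete_vertex_subset:
  "neighborhood (delete_vertex G v) u \<subseteq> verts G - {v}"
  by (auto simp: neighborhood_def delete_vertex_def induced_subgraph_def)

lemma neighborhood_symmetric:
  assumes "u \<in> verts G" and "w \<in> verts G"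
  shows "u \<in> neighborhood G w \<longleftrightarrow> w \<in> neighborhood G u"
  using assms by (simp add: neighborhood_def insert_commute)

text \<open>The three parts depend on the witness: one other than \<open>v\<close> leads to
  \<open>?C\<close> or \<open>?V\<close>, while \<open>v\<close> itself leads to \<open>?W\<close>
  unless another witness can replace it. The hypothesis \<open>ne\<close> provides such a
  replacement for the empty set.\<close>

lemma neighborhood_complex_split:
  assumes G: "simple_graph G" and v: "v \<in> verts G" and ne: "verts G \<noteq> {v}"
  defines "H \<equiv> delete_vertex G v"
  shows "neighborhood_complex G =
    neighborhood_complex H
      \<union> insert v ` (\<Union>u\<in>neighborhood G v. Pow (neighborhood H u))
      \<union> {U. U \<subseteq> neighborhood G v \<and> U \<noteq> {} \<and> (\<Inter>u\<in>U. neighborhood H u) = {}}"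
    (is "_ = ?C \<union> ?V \<union> ?W")
proof (intro subset_antisym subsetI)
  fix A assume "A \<in> neighborhood_complex G"
  then obtain w where w: "w \<in> verts G" "A \<subseteq> neighborhood G w" and A: "A \<subseteq> verts G"
    by (auto simp: neighborhood_complex_def)
  show "A \<in> ?C \<union> ?V \<union> ?W"
  proof (cases "w = v")
    case False
    then have N: "neighborhood H w = neighborhood G w - {v}"
      using w by (simp add: H_def neighborhood_delete_vertex)
    show ?thesis
    proof (cases "v \<in> A")
      case True
      then have "w \<in> neighborhood G v"
        using w v by (auto simp: neighborhood_symmetric)
      moreover have "A - {v} \<in> Pow (neighborhood H w)"
        using N w by auto
      moreover have "A = insert v (A - {v})"
        using True by auto
      ultimately show ?thesis by blast
    next
      case False
      then have "A \<in> ?C"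
        using w A N \<open>w \<noteq> v\<close> unfolding neighborhood_complex_def H_def verts_delete_vertex by auto
      then show ?thesis by blast
    qed
  next
    case True
    have vA: "v \<notin> A"
      using simple_graph_no_loop[OF G, of v] w True by (auto simp: neighborhood_def)
    show ?thesis
    proof (cases "A \<noteq> {} \<and> (\<Inter>u\<in>A. neighborhood H u) = {}")
      case True
      then show ?thesis using w \<open>w = v\<close> by auto
    next
      case False
      \<comment> \<open>The witness \<open>v\<close> is replaced: any second vertex serves for the
        empty set, and otherwise a common neighbour in \<open>H\<close> of all elements of
        \<open>A\<close> does, by symmetry of adjacency.\<close>
      have "\<exists>z\<in>verts G - {v}. A \<subseteq> neighborhood G z"
      proof (cases "A = {}")
        case True
        then show ?thesis using v ne by auto
      next
        case nonempty: False
        then obtain z where z: "\<And>u. u \<in> A \<Longrightarrow> z \<in> neighborhood H u"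
          using False by auto
        then have "z \<in> verts G - {v}"
          using nonempty neighborhood_delete_vertex_subset[of G v] unfolding H_def by blast
        moreover have "A \<subseteq> neighborhood G z"
        proof
          fix u assume "u \<in> A"
          then show "u \<in> neighborhood G z"
            using z[of u] A calculation neighborhood_symmetric[of u G z]
            by (auto simp: H_def neighborhood_delete_vertex split: if_splits)
        qed
        ultimately show ?thesis by blast
      qed
      then have "A \<in> ?C"
        using vA A unfolding neighborhood_complex_def H_def
        by (auto simp: verts_delete_vertex neighborhood_delete_vertex)
      then show ?thesis by blast
    qed
  qed
next
  have sub: "neighborhood G u \<subseteq> verts G" for u
    by (auto simp: neighborhood_def)
  fix A assume "A \<in> ?C \<union> ?V \<union> ?W"
  then consider "A \<in> ?C" | "A \<in> ?V" | "A \<in> ?W" by blast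
  then show "A \<in> neighborhood_complex G"
  proof cases
    case 1
    then show ?thesis
      by (fastforce simp: neighborhood_complex_def H_def verts_delete_vertex neighborhood_delete_vertex)
  next
    case 2
    then obtain u B where u: "u \<in> neighborhood G v" and B: "B \<subseteq> neighborhood H u" "A = insert v B"
      by auto
    have uV: "u \<in> verts G" using u sub by auto
    have "neighborhood H u \<subseteq> neighborhood G u"
      by (auto simp: H_def neighborhood_delete_vertex)
    moreover have "v \<in> neighborhood G u"
      using u uV v by (simp add: neighborhood_symmetric)
    ultimately have "A \<subseteq> neighborhood G u" using B by auto
    then show ?thesis
      using sub[of u] uV by (auto simp: neighborhood_complex_def)
  next
    case 3
    then show ?thesis using v sub[of v] by (auto simp: neighborhood_complex_def)
  qed
qed

text \<open>The condition \<open>verts G \<noteq> {v}\<close> excludes the one-vertex graph: there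
  the left side is 1, but the right side is 0 because the complex of the graph without vertices is
  empty.\<close>

theorem corollary10:
  fixes G :: "'a graph" and v :: 'a and x :: "int poly"
  defines "x \<equiv> monom 1 1"
  assumes "simple_graph G"
    and "v \<in> verts G"
    and "verts G \<noteq> {v}"
  shows "neighborhood_poly G =
      neighborhood_poly (delete_vertex G v)
    + (\<Sum>U | U \<subseteq> neighborhood G v \<and> U \<noteq> {}.
         (- 1) ^ (card U + 1) * x * (1 + x) ^ card (\<Inter>u\<in>U. neighborhood (delete_vertex G v) u))
    + (\<Sum>U | U \<subseteq> neighborhood G v \<and> U \<noteq> {}.
         if (\<Inter>u\<in>U. neighborhood (delete_vertex G v) u) = {} then x ^ card U else 0)"
proof -
  define H where "H = delete_vertex G v"
  define N where "N = neighborhood G v"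
  define B where "B = (\<Union>u\<in>N. Pow (neighborhood H u))"
  define W where "W = {U. U \<subseteq> N \<and> U \<noteq> {} \<and> (\<Inter>u\<in>U. neighborhood H u) = {}}"
  have poly: "neighborhood_poly K = (\<Sum>A\<in>neighborhood_complex K. x ^ card A)" for K :: "'a graph"
    by (simp add: neighborhood_poly_def x_def monom_power)
  have finV: "finite (verts G)"
    using assms by (simp add: simple_graph_def)
  have NG: "neighborhood G u \<subseteq> verts G" for u
    by (auto simp: neighborhood_def)
  have NH: "neighborhood H u \<subseteq> verts G - {v}" for u
    unfolding H_def by (rule neighborhood_delete_vertex_subset)
  have finN: "finite N" and finH: "finite (neighborhood H u)" for u
    using finV NG NH unfolding N_def by (meson finite_subset finite_Diff)+
  have vN: "v \<notin> N"
    using simple_graph_no_loop[of G v] assms by (auto simp: N_def neighborhood_def)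
  have finB: "finite B"
    using finN finH by (simp add: B_def)
  have vB: "v \<notin> b" if "b \<in> B" for b
    using that NH by (auto simp: B_def)
  have finW: "finite W"
    by (rule finite_subset[of _ "Pow N"]) (auto simp: W_def finN)
  have finC: "finite (neighborhood_complex H)"
    by (rule finite_subset[of _ "Pow (verts G)"])
      (auto simp: neighborhood_complex_def H_def verts_delete_vertex finV)

  \<comment> \<open>A witness in \<open>H\<close> for \<open>U\<close> would be a common neighbour
    of its elements, which membership in \<open>W\<close> forbids.\<close>
  have CW: "neighborhood_complex H \<inter> W = {}"
  proof (intro equals0I, elim IntE)
    fix U assume "U \<in> neighborhood_complex H" and U: "U \<in> W"
    then obtain z where z: "z \<in> verts G - {v}" "U \<subseteq> neighborhood H z"
      by (auto simp: neighborhood_complex_def H_def verts_delete_vertex)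
    have "z \<in> neighborhood H u" if "u \<in> U" for u
    proof -
      have "u \<in> neighborhood G z" "u \<in> verts G - {v}"
        using that z NH[of z] by (auto simp: H_def neighborhood_delete_vertex split: if_splits)
      then show ?thesis
        using z by (auto simp: H_def neighborhood_delete_vertex neighborhood_symmetric[of u G z])
    qed
    then show False using U by (auto simp: W_def)
  qed
  have CV: "(neighborhood_complex H \<union> W) \<inter> insert v ` B = {}"
    using vN by (auto simp: W_def neighborhood_complex_def H_def verts_delete_vertex)
  have split: "neighborhood_complex G = (neighborhood_complex H \<union> W) \<union> insert v ` B"
    using neighborhood_complex_split[of G v] assms by (auto simp: H_def W_def B_def N_def)

  \<comment> \<open>No member of \<open>B\<close> contains \<open>v\<close>, so
    \<open>insert v\<close> is injective on \<open>B\<close> and raises each cardinality by one;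
    this is the source of the extra factor \<open>x\<close>.\<close>
  have "(\<Sum>A\<in>insert v ` B. x ^ card A) = (\<Sum>b\<in>B. x ^ card (insert v b))"
    by (rule sum.reindex_cong[OF _ refl refl]) (meson inj_onI insert_ident vB)
  also have "\<dots> = (\<Sum>b\<in>B. x * x ^ card b)"
  proof (rule sum.cong[OF refl])
    fix b assume b: "b \<in> B"
    then have "finite b"
      using finH by (auto simp: B_def intro: finite_subset)
    then show "x ^ card (insert v b) = x * x ^ card b"
      using vB[OF b] by simp
  qed
  also have "\<dots> = (\<Sum>U | U \<subseteq> N \<and> U \<noteq> {}. (- 1) ^ (card U + 1) *
      (\<Sum>b\<in>(\<Inter>u\<in>U. Pow (neighborhood H u)). x * x ^ card b))"
    unfolding B_def using finN finH by (intro sum_UNION_inclusion_exclusion) auto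
  also have "\<dots> = (\<Sum>U | U \<subseteq> N \<and> U \<noteq> {}. (- 1) ^ (card U + 1) * x *
      (1 + x) ^ card (\<Inter>u\<in>U. neighborhood H u))"
  proof (rule sum.cong[OF refl])
    fix U assume "U \<in> {U. U \<subseteq> N \<and> U \<noteq> {}}"
    \<comment> \<open>Here \<open>U \<noteq> {}\<close> matters, since the intersection over the
      empty family is \<open>UNIV\<close>.\<close>
    then have "finite (\<Inter>u\<in>U. neighborhood H u)"
      using finH by auto
    moreover have "(\<Inter>u\<in>U. Pow (neighborhood H u)) = Pow (\<Inter>u\<in>U. neighborhood H u)"
      by auto
    ultimately show "(- 1) ^ (card U + 1) * (\<Sum>b\<in>(\<Inter>u\<in>U. Pow (neighborhood H u)). x * x ^ card b)
        = (- 1) ^ (card U + 1) * x * (1 + x) ^ card (\<Inter>u\<in>U. neighborhood H u)"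
      by (simp add: sum_Pow_power_card flip: sum_distrib_left)
  qed
  finally have sumV: "(\<Sum>A\<in>insert v ` B. x ^ card A) = \<dots>" .

  \<comment> \<open>The default 0 extends the sum from \<open>W\<close> to all nonempty subsets of
    \<open>N\<close>.\<close>
  have sumW: "(\<Sum>U\<in>W. x ^ card U) = (\<Sum>U | U \<subseteq> N \<and> U \<noteq> {}.
      if (\<Inter>u\<in>U. neighborhood H u) = {} then x ^ card U else 0)"
    using finN by (simp add: W_def conj_assoc flip: sum.inter_filter)

  have "neighborhood_poly G = (\<Sum>A\<in>neighborhood_complex H. x ^ card A) + (\<Sum>U\<in>W. x ^ card U)
      + (\<Sum>A\<in>insert v ` B. x ^ card A)"
    unfolding poly split using finB finW finC CV CW by (simp add: sum.union_disjoint)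
  then show ?thesis
    unfolding sumV sumW poly[symmetric] by (simp only: H_def N_def ac_simps)
qed

end
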